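(* Let $\Delta t_m>0$, let $\vec X^m\in \underline V^h_{\partial_0}$, and let $(\vec X^{m+1},\kappa^{m+1})$, with $\vec X^{m+1}-\vec X^m\in\underline V^h_{\partial}$ and $\kappa^{m+1}\in V^h$, be a solution of the fully discrete scheme $$\frac{1}{\Delta t_m}\bigl\langle \vec X^{m+1}-\vec X^m,\ \chi\,\vec f^{\,m+\frac12}\bigr\rangle-\bigl\langle (\vec X^m\cdot\vec e_1)\,\bigl[\kappa^{m+1}-\lambda^{m+\frac12}(\kappa^{m+1})\bigr]_\rho,\ \chi_\rho\,|\vec X^m_\rho|^{-1}\bigr\rangle=0\qquad\forall\,\chi\in V^h,$$ $$\bigl\langle \kappa^{m+1}\,\vec\nu^m,\ \vec\eta\,|\vec X^m_\rho|\bigr\rangle^h+\bigl\langle \vec X^{m+1}_\rho,\ \vec\eta_\rho\,|\vec X^m_\rho|^{-1}\bigr\rangle=0\qquad\forall\,\vec\eta\in\underline V^h_{\partial}.$$ Then $M(\vec X^{m+1})=M(\vec X^m)$.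
   Context: Domain and boundary. Either $\mathbb I=\mathbb R/\mathbb Z$ (with $\partial\mathbb I=\emptyset$) or $\mathbb I=(0,1)$ (with $\partial\mathbb I=\{0,1\}$). $\partial\mathbb I=\partial_D\mathbb I\cup\partial_0\mathbb I\cup\partial_1\mathbb I\cup\partial_2\mathbb I$ is a given disjoint partition. $\vec e_1,\vec e_2$ is the standard basis of $\mathbb R^2$; $\langle\cdot,\cdot\rangle$ is the $L^2$ inner product over $\mathbb I$ (scalar or vector valued); subscript $\rho$ is the derivative on $\mathbb I$ (piecewise for finite element functions); $(a,b)^\perp=(b,-a)$ is clockwise rotation by $\pi/2$. Finite element spaces. For an integer $J\ge3$, $h=1/J$, $q_j=jh$, $\mathbb I_j=[q_{j-1},q_j]$. $V^h$ is the space of continuous functions on $\overline{\mathbb I}$ that are affine on each $\mathbb I_j$ (periodic if $\mathbb I=\mathbb R/\mathbb Z$). $\underline V^h_{\partial_0}=\{\vec\eta\in[V^h]^2:\vec\eta(\rho)\cdot\vec e_1=0\ \forall\rho\in\partial_0\mathbb I\}$, and $\underline V^h_{\partial}=\{\vec\eta\in\underline V^h_{\partial_0}:\vec\eta(\rho)\cdot\vec e_i=0\ \forall\rho\in\partial_i\mathbb I,\ i=1,2;\ \vec\eta(\rho)=\vec 0\ \forall\rho\in\partial_D\mathbb I\}$. Mass-lumped inner product: for piecewise continuous $\vec v,\vec w$ with possible jumps at the nodes, $\langle\vec v,\vec w\rangle^h=\frac h2\sum_{j=1}^J[(\vec v\cdot\vec w)(q_j^-)+(\vec v\cdot\vec w)(q_{j-1}^+)]$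 with $g(q_j^\pm)=\lim_{\delta\searrow0}g(q_j\pm\delta)$. Standing assumptions. For $\vec X\in\{\vec X^m,\vec X^{m+1}\}$: $\vec X\cdot\vec e_1>0$ in $\overline{\mathbb I}\setminus\partial_0\mathbb I$ and $|\vec X_\rho|>0$ in $\mathbb I$ (on each element). $\vec X$ parameterizes the generating curve of a surface rotationally symmetric about the $x_2$-axis. $\vec\nu^m=-|\vec X^m_\rho|^{-1}(\vec X^m_\rho)^\perp$. Definition of $\lambda^{m+\frac12}$: let $\vec\omega^m\in[V^h]^2$ satisfy $\langle\vec\omega^m,\vec\varphi\,|\vec X^m_\rho|\rangle^h=\langle\vec\nu^m,\vec\varphi\,|\vec X^m_\rho|\rangle$ for all $\vec\varphi\in[V^h]^2$. For $\kappa^{m+1}\in V^h$, $\lambda^{m+\frac12}(\kappa^{m+1})\in V^h$ is the function with nodal values $-\kappa^{m+1}(q_j)$ if $q_j\in\partial_0\mathbb I$, and $\dfrac{\vec\omega^m(q_j)\cdot\vec e_1}{\vec X^m(q_j)\cdot\vec e_1}$ otherwise. Time-averaged weighted normal: $$\vec f^{\,m+\frac12}=-\tfrac16\Bigl(2(\vec X^m\cdot\vec e_1)\vec X^m_\rho+2(\vec X^{m+1}\cdot\vec e_1)\vec X^{m+1}_\rho+(\vec X^m\cdot\vec e_1)\vec X^{m+1}_\rho+(\vec X^{m+1}\cdot\vec e_1)\vec X^m_\rho\Bigr)^\perp .$$ Enclosed volume (up to an additive constant): $M(\vec X)=\pi\langle(\vec X\cdot\vec e_1)^2\,\vec\nu,\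 \vec e_1\,|\vec X_\rho|\rangle+\pi\sum_{p\in\partial_1\mathbb I}(-1)^{p+1}(\vec X(p)\cdot\vec e_1)^2\,\vec X(p)\cdot\vec e_2$, where $\vec\nu=-|\vec X_\rho|^{-1}(\vec X_\rho)^\perp$ is the unit normal (the parameterization being oriented so that $\vec\nu$ is the outer normal). *)

theory Defs
  imports "HOL-Analysis.Analysis"
begin

text \<open>
  The parameter domain is either the circle R/Z or the interval (0,1).  A function on R/Z is a
  1-periodic function on the reals; a function on [0,1] is a function on the reals of which only
  the values on [0,1] matter.
\<close>

datatype domain = Circle | Interval

definition dom_closure :: "domain \<Rightarrow> real set" where
  "dom_closure I = (case I of Circle \<Rightarrow> UNIV | Interval \<Rightarrow> {0..1})"

definition dom_boundary :: "domain \<Rightarrow> real set" where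
  "dom_boundary I = (case I of Circle \<Rightarrow> {} | Interval \<Rightarrow> {0, 1})"

definition boundary_partition ::
    "domain \<Rightarrow> real set \<Rightarrow> real set \<Rightarrow> real set \<Rightarrow> real set \<Rightarrow> bool" where
  "boundary_partition I BD B0 B1 B2 \<longleftrightarrow>
     dom_boundary I = BD \<union> B0 \<union> B1 \<union> B2 \<and>
     BD \<inter> B0 = {} \<and> BD \<inter> B1 = {} \<and> BD \<inter> B2 = {} \<and>
     B0 \<inter> B1 = {} \<and> B0 \<inter> B2 = {} \<and> B1 \<inter> B2 = {}"

definition e1 :: "real^2" where "e1 = axis 1 1"
definition e2 :: "real^2" where "e2 = axis 2 1"

definition perp :: "real^2 \<Rightarrow> real^2" where
  "perp v = vector [v $ 2, - (v $ 1)]"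

definition node :: "nat \<Rightarrow> nat \<Rightarrow> real" where
  "node J j = real j * (1 / real J)"

definition Vh :: "domain \<Rightarrow> nat \<Rightarrow> (real \<Rightarrow> real) set" where
  "Vh I J = {f. continuous_on (dom_closure I) f \<and>
       (\<forall>j\<in>{1..J}. \<exists>a b. \<forall>\<rho>\<in>{node J (j - 1)..node J j}. f \<rho> = a + b * \<rho>) \<and>
       (I = Circle \<longrightarrow> (\<forall>\<rho>. f (\<rho> + 1) = f \<rho>))}"

definition Vh2 :: "domain \<Rightarrow> nat \<Rightarrow> (real \<Rightarrow> real^2) set" where
  "Vh2 I J = {\<eta>. \<forall>i. (\<lambda>\<rho>. \<eta> \<rho> $ i) \<in> Vh I J}"

definition Vh2_axis :: "domain \<Rightarrow> nat \<Rightarrow> real set \<Rightarrow> (real \<Rightarrow> real^2) set" where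
  "Vh2_axis I J B0 = {\<eta> \<in> Vh2 I J. \<forall>\<rho>\<in>B0. \<eta> \<rho> \<bullet> e1 = 0}"

definition Vh2_bdry ::
    "domain \<Rightarrow> nat \<Rightarrow> real set \<Rightarrow> real set \<Rightarrow> real set \<Rightarrow> real set \<Rightarrow> (real \<Rightarrow> real^2) set" where
  "Vh2_bdry I J BD B0 B1 B2 = {\<eta> \<in> Vh2_axis I J B0.
       (\<forall>\<rho>\<in>B1. \<eta> \<rho> \<bullet> e1 = 0) \<and> (\<forall>\<rho>\<in>B2. \<eta> \<rho> \<bullet> e2 = 0) \<and> (\<forall>\<rho>\<in>BD. \<eta> \<rho> = 0)}"

text \<open>
  The derivative is piecewise: for a finite element function its value at a node, where the
  function need not be differentiable, is arbitrary.  The nodes form a null set for the integral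
  below, and the mass-lumped product only sees one-sided limits at them.
\<close>

definition Drho :: "(real \<Rightarrow> 'a::real_normed_vector) \<Rightarrow> real \<Rightarrow> 'a" where
  "Drho f \<rho> = vector_derivative f (at \<rho>)"

definition L2_inner :: "(real \<Rightarrow> 'a::real_inner) \<Rightarrow> (real \<Rightarrow> 'a) \<Rightarrow> real" where
  "L2_inner v w = integral {0..1} (\<lambda>\<rho>. v \<rho> \<bullet> w \<rho>)"

definition lumped_inner ::
    "nat \<Rightarrow> (real \<Rightarrow> 'a::real_inner) \<Rightarrow> (real \<Rightarrow> 'a) \<Rightarrow> real" where
  "lumped_inner J v w = (1 / real J) / 2 *
     (\<Sum>j = 1..J. Lim (at_left (node J j)) (\<lambda>\<rho>. v \<rho> \<bullet> w \<rho>) +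
                  Lim (at_right (node J (j - 1))) (\<lambda>\<rho>. v \<rho> \<bullet> w \<rho>))"

definition admissible_curve ::
    "domain \<Rightarrow> nat \<Rightarrow> real set \<Rightarrow> (real \<Rightarrow> real^2) \<Rightarrow> bool" where
  "admissible_curve I J B0 X \<longleftrightarrow>
     (\<forall>\<rho> \<in> dom_closure I - B0. X \<rho> \<bullet> e1 > 0) \<and>
     (\<forall>j\<in>{1..J}. \<forall>\<rho>\<in>{node J (j - 1)<..<node J j}. norm (Drho X \<rho>) > 0)"

definition unit_normal :: "(real \<Rightarrow> real^2) \<Rightarrow> real \<Rightarrow> real^2" where
  "unit_normal X \<rho> = - (inverse (norm (Drho X \<rho>)) *\<^sub>R perp (Drho X \<rho>))"

definition is_omega ::
    "domain \<Rightarrow> nat \<Rightarrow> (real \<Rightarrow> real^2) \<Rightarrow> (real \<Rightarrow> real^2) \<Rightarrow> bool" where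
  "is_omega I J X \<omega> \<longleftrightarrow> \<omega> \<in> Vh2 I J \<and>
     (\<forall>\<phi>\<in>Vh2 I J.
        lumped_inner J \<omega> (\<lambda>\<rho>. norm (Drho X \<rho>) *\<^sub>R \<phi> \<rho>) =
        L2_inner (unit_normal X) (\<lambda>\<rho>. norm (Drho X \<rho>) *\<^sub>R \<phi> \<rho>))"

text \<open>
  The nodal values determine \<open>l\<close> on the closure of the domain, so \<open>is_lambda\<close> is the graph of
  the map sending \<open>\<kappa>\<close> to \<open>\<lambda>(\<kappa>)\<close>.
\<close>

definition is_lambda ::
    "domain \<Rightarrow> nat \<Rightarrow> real set \<Rightarrow> (real \<Rightarrow> real^2) \<Rightarrow> (real \<Rightarrow> real^2) \<Rightarrow>
     (real \<Rightarrow> real) \<Rightarrow> (real \<Rightarrow> real) \<Rightarrow> bool" where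
  "is_lambda I J B0 X \<omega> \<kappa> l \<longleftrightarrow> l \<in> Vh I J \<and>
     (\<forall>j\<in>{0..J}. l (node J j) =
        (if node J j \<in> B0 then - \<kappa> (node J j)
         else (\<omega> (node J j) \<bullet> e1) / (X (node J j) \<bullet> e1)))"

definition f_half :: "(real \<Rightarrow> real^2) \<Rightarrow> (real \<Rightarrow> real^2) \<Rightarrow> real \<Rightarrow> real^2" where
  "f_half X Y \<rho> = - ((1/6) *\<^sub>R perp
     ((2 * (X \<rho> \<bullet> e1)) *\<^sub>R Drho X \<rho> + (2 * (Y \<rho> \<bullet> e1)) *\<^sub>R Drho Y \<rho> +
      (X \<rho> \<bullet> e1) *\<^sub>R Drho Y \<rho> + (Y \<rho> \<bullet> e1) *\<^sub>R Drho X \<rho>))"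

text \<open>
  \<open>B1\<close> is a subset of \<open>{0, 1}\<close>, so the exponent \<open>nat \<lfloor>p\<rfloor> + 1\<close> is the natural number \<open>p + 1\<close>.
  The volume is up to an additive constant.
\<close>

definition enclosed_volume :: "real set \<Rightarrow> (real \<Rightarrow> real^2) \<Rightarrow> real" where
  "enclosed_volume B1 X =
     pi * L2_inner (\<lambda>\<rho>. (X \<rho> \<bullet> e1)\<^sup>2 *\<^sub>R unit_normal X \<rho>) (\<lambda>\<rho>. norm (Drho X \<rho>) *\<^sub>R e1) +
     pi * (\<Sum>p\<in>B1. (-1) ^ (nat \<lfloor>p\<rfloor> + 1) * (X p \<bullet> e1)\<^sup>2 * (X p \<bullet> e2))"

end

theory Submission
  imports Defs
begin

text \<open>
  Take the constant test function \<open>\<zeta> = 1\<close>: its derivative vanishes, so the first equation of the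
  scheme becomes \<open>\<langle>Y - X, f\<rangle> = 0\<close>, where \<open>f\<close> is the time-averaged weighted normal.  It remains
  to see that the change of volume is \<open>2 * pi * \<langle>Y - X, f\<rangle>\<close> for any two finite element curves
  that respect the boundary conditions (\<open>enclosed_volume_change\<close>).

  Since \<open>|X'| \<nu> = - perp X'\<close>, the integral part of the volume is \<open>- pi\<close> times the integral of
  \<open>(X $ 1)\<^sup>2 * (X' $ 2)\<close>.  Differentiate this along the segment \<open>Z = X + t * (Y - X)\<close>, move the
  derivative off \<open>(Y - X)'\<close> by an integration by parts in the parameter of the curve, and average
  over \<open>t\<close> in \<open>[0, 1]\<close>.  The vector \<open>f\<close> is exactly the average of \<open>- (Z $ 1) *\<^sub>R perp Z'\<close>,
  so what one gets is \<open>2 * pi * \<langle>Y - X, f\<rangle>\<close> together with the boundary values of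
  \<open>- pi * ((X $ 1)\<^sup>2 + X $ 1 * Y $ 1 + (Y $ 1)\<^sup>2) / 3 * ((Y - X) $ 2)\<close>.
  Carried out pointwise this is one polynomial identity (\<open>volume_density_identity\<close>), followed by
  the fundamental theorem of calculus (\<open>volume_density_change\<close>).

  On the circle the two boundary values cancel.  On the interval they vanish at an end point
  where the curve is fixed, lies on the axis, or moves only horizontally; at an end point in
  \<open>B1\<close> the radius is fixed, and the boundary value is compensated by the change of the boundary
  term in the definition of the volume.
\<close>

section \<open>Calculus of finite element functions\<close>

lemma inner_e1 [simp]: "v \<bullet> e1 = v $ 1"
  by (simp add: e1_def inner_axis)

lemma inner_e2 [simp]: "v \<bullet> e2 = v $ 2"
  by (simp add: e2_def inner_axis)

lemma node_0 [simp]: "node J 0 = 0"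
  by (simp add: node_def)

lemma node_last: "J > 0 \<Longrightarrow> node J J = 1"
  by (simp add: node_def)

lemma node_mono: "i \<le> j \<Longrightarrow> node J i \<le> node J j"
  by (simp add: node_def divide_right_mono)

lemma Icc_subset_dom_closure: "{0..1} \<subseteq> dom_closure I"
  by (cases I) (auto simp: dom_closure_def)

lemma Vh_continuous_on: "v \<in> Vh I J \<Longrightarrow> continuous_on {0..1} v"
  unfolding Vh_def by (auto intro: continuous_on_subset[OF _ Icc_subset_dom_closure])

lemma Vh_affine:
  assumes "v \<in> Vh I J" "j \<in> {1..J}"
  shows "\<exists>a b. \<forall>\<rho>\<in>{node J (j - 1)..node J j}. v \<rho> = a + b * \<rho>"
  using assms by (simp add: Vh_def)

lemma Vh_circle_closed:
  assumes "v \<in> Vh Circle J"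
  shows "v 1 = v 0"
proof -
  have "v (0 + 1) = v 0"
    using assms unfolding Vh_def by blast
  then show ?thesis by simp
qed

lemma non_node_in_element:
  assumes "J > 0" "\<rho> \<in> {0..1}" "\<rho> \<notin> node J ` {0..J}"
  obtains j where "j \<in> {1..J}" "\<rho> \<in> {node J (j - 1)<..<node J j}"
proof -
  define j where "j = (LEAST j. \<rho> < node J j)"
  have last: "\<rho> < node J J"
    using assms(2,3) node_last[OF assms(1)] by (cases "\<rho> = node J J") auto
  have less: "\<rho> < node J j"
    unfolding j_def using last by (rule LeastI)
  have le: "j \<le> J"
    unfolding j_def using last by (rule Least_le)
  have pos: "j \<noteq> 0"
  proof
    assume "j = 0"
    then show False
      using less assms(2) by simp
  qed
  then have "\<not> \<rho> < node J (j - 1)"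
    using not_less_Least[of "j - 1" "\<lambda>j. \<rho> < node J j"] by (simp add: j_def)
  moreover have "\<rho> \<noteq> node J (j - 1)"
    using assms(3) le by auto
  ultimately show thesis
    using that[of j] less le pos by simp
qed

lemma Vh_has_field_derivative_element:
  assumes "j \<in> {1..J}" "\<And>\<rho>. \<rho> \<in> {node J (j - 1)..node J j} \<Longrightarrow> v \<rho> = a + b * \<rho>"
    "\<rho> \<in> {node J (j - 1)<..<node J j}"
  shows "(v has_field_derivative b) (at \<rho>)"
proof (rule has_field_derivative_transform_within_open[where S = "{node J (j - 1)<..<node J j}"])
  show "((\<lambda>\<rho>. a + b * \<rho>) has_field_derivative b) (at \<rho>)"
    by (auto intro!: derivative_eq_intros)
qed (use assms in auto)

lemma Vh2_component_has_derivative: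
  assumes "X \<in> Vh2 I J" "J > 0" "\<rho> \<in> {0..1} - node J ` {0..J}"
  shows "((\<lambda>\<rho>. X \<rho> $ i) has_field_derivative (Drho X \<rho> $ i)) (at \<rho>)"
proof -
  obtain j where j: "j \<in> {1..J}" "\<rho> \<in> {node J (j - 1)<..<node J j}"
    using non_node_in_element assms by (metis DiffD1 DiffD2)
  have "\<exists>a b. \<forall>\<rho>\<in>{node J (j - 1)..node J j}. X \<rho> $ k = a + b * \<rho>" for k
    using assms(1) by (intro Vh_affine[where I = I, OF _ j(1)]) (simp add: Vh2_def)
  then obtain a b where ab: "\<And>k \<rho>. \<rho> \<in> {node J (j - 1)..node J j} \<Longrightarrow> X \<rho> $ k = a k + b k * \<rho>"
    by metis
  have "(X has_vector_derivative (\<chi> k. b k)) (at \<rho>)"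
  proof (rule has_vector_derivative_transform_within_open
      [where S = "{node J (j - 1)<..<node J j}"])
    show "((\<lambda>\<rho>. (\<chi> k. a k) + \<rho> *\<^sub>R (\<chi> k. b k)) has_vector_derivative (\<chi> k. b k)) (at \<rho>)"
      by (auto intro!: derivative_eq_intros)
  qed (use j ab in \<open>auto simp: vec_eq_iff\<close>)
  then have "Drho X \<rho> = (\<chi> k. b k)"
    unfolding Drho_def by (rule vector_derivative_at)
  then show ?thesis
    using Vh_has_field_derivative_element[OF j(1) ab j(2)] by simp
qed

lemma integrable_on_elements:
  fixes g :: "real \<Rightarrow> real"
  assumes "\<And>j. j \<in> {1..n} \<Longrightarrow> g integrable_on {node J (j - 1)..node J j}"
  shows "g integrable_on {0..node J n}"
  using assms
proof (induction n)
  case 0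
  then show ?case
    using integrable_on_refl[of g 0] by simp
next
  case (Suc n)
  have "g integrable_on {0..node J n}" "g integrable_on {node J n..node J (Suc n)}"
    using Suc.IH Suc.prems Suc.prems[of "Suc n"] by auto
  moreover have "0 \<le> node J n" "node J n \<le> node J (Suc n)"
    using node_mono[of 0 n J] node_mono[of n "Suc n" J] by simp_all
  ultimately show ?case
    by (meson Henstock_Kurzweil_Integration.integrable_combine)
qed

text \<open>
  On one element the derivative is constant except at the two end points, where it is arbitrary,
  so the integrand is continuous up to finitely many points.
\<close>

lemma integrable_volume_density:
  assumes "X \<in> Vh2 I J" "J > 0"
  shows "(\<lambda>\<rho>. (X \<rho> $ 1)\<^sup>2 * Drho X \<rho> $ 2) integrable_on {0..1}"
proof -
  have "(\<lambda>\<rho>. (X \<rho> $ 1)\<^sup>2 * Drho X \<rho> $ 2) integrable_on {node J (j - 1)..node J j}"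
    if j: "j \<in> {1..J}" for j
  proof -
    have V: "(\<lambda>\<rho>. X \<rho> $ i) \<in> Vh I J" for i
      using assms(1) by (simp add: Vh2_def)
    obtain a b where ab: "\<And>\<rho>. \<rho> \<in> {node J (j - 1)..node J j} \<Longrightarrow> X \<rho> $ 2 = a + b * \<rho>"
      using Vh_affine[OF V[of 2] j] by blast
    have sub: "{node J (j - 1)..node J j} \<subseteq> {0..1}"
      using node_mono[of 0 "j - 1" J] node_mono[of j J J] node_last[OF assms(2)] j by auto
    have "(\<lambda>\<rho>. (X \<rho> $ 1)\<^sup>2 * b) integrable_on {node J (j - 1)..node J j}"
      by (intro integrable_continuous_real continuous_intros
          continuous_on_subset[OF Vh_continuous_on[OF V[of 1]] sub])
    then show ?thesis
    proof (rule integrable_spike_finite[rotated 2])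
      fix \<rho> assume \<rho>: "\<rho> \<in> {node J (j - 1)..node J j} - node J ` {0..J}"
      have "j - 1 \<in> {0..J}" "j \<in> {0..J}"
        using j by auto
      then have "\<rho> \<noteq> node J (j - 1)" "\<rho> \<noteq> node J j"
        using \<rho> by blast+
      then have "\<rho> \<in> {node J (j - 1)<..<node J j}"
        using \<rho> by simp
      then have "((\<lambda>\<rho>. X \<rho> $ 2) has_field_derivative b) (at \<rho>)"
        using Vh_has_field_derivative_element[of j J "\<lambda>\<rho>. X \<rho> $ 2"] j ab by blast
      moreover have "\<rho> \<in> {0..1} - node J ` {0..J}"
        using \<rho> sub by blast
      then have "((\<lambda>\<rho>. X \<rho> $ 2) has_field_derivative (Drho X \<rho> $ 2)) (at \<rho>)"
        by (rule Vh2_component_has_derivative[OF assms])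
      ultimately have "Drho X \<rho> $ 2 = b"
        using DERIV_unique by blast
      then show "(X \<rho> $ 1)\<^sup>2 * Drho X \<rho> $ 2 = (X \<rho> $ 1)\<^sup>2 * b"
        by simp
    qed simp
  qed
  then show ?thesis
    using integrable_on_elements[of J _ J] unfolding node_last[OF assms(2)] by blast
qed

section \<open>The change of volume between two curves\<close>

lemma enclosed_volume_eq:
  "enclosed_volume B1 X = - pi * integral {0..1} (\<lambda>\<rho>. (X \<rho> $ 1)\<^sup>2 * Drho X \<rho> $ 2)
     + pi * (\<Sum>p\<in>B1. (-1) ^ (nat \<lfloor>p\<rfloor> + 1) * (X p $ 1)\<^sup>2 * (X p $ 2))"
proof -
  \<comment> \<open>Multiplying by the length element removes the normalisation; at a point where the
    derivative is zero both sides vanish.\<close>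
  have "((X \<rho> \<bullet> e1)\<^sup>2 *\<^sub>R unit_normal X \<rho>) \<bullet> (norm (Drho X \<rho>) *\<^sub>R e1)
      = - ((X \<rho> $ 1)\<^sup>2 * Drho X \<rho> $ 2)" for \<rho>
    by (cases "Drho X \<rho> = 0") (auto simp: unit_normal_def perp_def)
  then show ?thesis
    unfolding enclosed_volume_def L2_inner_def by simp
qed

text \<open>
  For a segment \<open>Z = X + t * (Y - X)\<close> write \<open>D = Y - X\<close>.  Then the \<open>t\<close>-derivative of
  \<open>(Z $ 1)\<^sup>2 * (Z' $ 2)\<close> is \<open>2 * (Z $ 1) * (D $ 1 * Z' $ 2 - D $ 2 * Z' $ 1)\<close> plus the
  derivative of \<open>(Z $ 1)\<^sup>2 * (D $ 2)\<close>.  The identity is this equation integrated over \<open>t\<close>; the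
  integral of \<open>(Z $ 1)\<^sup>2\<close> gives the quadratic form divided by 3, whose derivative appears
  expanded on the right.
\<close>

lemma volume_density_identity:
  "2 * ((Y \<rho> - X \<rho>) \<bullet> f_half X Y \<rho>) =
     (X \<rho> $ 1)\<^sup>2 * Drho X \<rho> $ 2 - (Y \<rho> $ 1)\<^sup>2 * Drho Y \<rho> $ 2
     + ((2 * X \<rho> $ 1 * Drho X \<rho> $ 1 + X \<rho> $ 1 * Drho Y \<rho> $ 1 + Drho X \<rho> $ 1 * Y \<rho> $ 1
          + 2 * Y \<rho> $ 1 * Drho Y \<rho> $ 1) / 3 * (Y \<rho> $ 2 - X \<rho> $ 2)
        + ((X \<rho> $ 1)\<^sup>2 + X \<rho> $ 1 * Y \<rho> $ 1 + (Y \<rho> $ 1)\<^sup>2) / 3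
          * (Drho Y \<rho> $ 2 - Drho X \<rho> $ 2))"
  unfolding f_half_def inner_e1
  by (simp add: perp_def inner_vec_def sum_2 field_simps power2_eq_square)

lemma volume_density_change:
  fixes X Y :: "real \<Rightarrow> real^2"
  defines "Q \<equiv> \<lambda>\<rho>. ((X \<rho> $ 1)\<^sup>2 + X \<rho> $ 1 * Y \<rho> $ 1 + (Y \<rho> $ 1)\<^sup>2) / 3 * (Y \<rho> $ 2 - X \<rho> $ 2)"
  assumes X: "X \<in> Vh2 I J" and Y: "Y \<in> Vh2 I J" and J: "J > 0"
  shows "2 * L2_inner (\<lambda>\<rho>. Y \<rho> - X \<rho>) (f_half X Y) =
     integral {0..1} (\<lambda>\<rho>. (X \<rho> $ 1)\<^sup>2 * Drho X \<rho> $ 2)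
     - integral {0..1} (\<lambda>\<rho>. (Y \<rho> $ 1)\<^sup>2 * Drho Y \<rho> $ 2) + (Q 1 - Q 0)"
proof -
  have cont: "continuous_on {0..1} (\<lambda>\<rho>. X \<rho> $ i)" "continuous_on {0..1} (\<lambda>\<rho>. Y \<rho> $ i)" for i
    using X Y Vh_continuous_on unfolding Vh2_def by blast+
  define q where "q = (\<lambda>\<rho>.
     (2 * X \<rho> $ 1 * Drho X \<rho> $ 1 + X \<rho> $ 1 * Drho Y \<rho> $ 1 + Drho X \<rho> $ 1 * Y \<rho> $ 1
          + 2 * Y \<rho> $ 1 * Drho Y \<rho> $ 1) / 3 * (Y \<rho> $ 2 - X \<rho> $ 2)
        + ((X \<rho> $ 1)\<^sup>2 + X \<rho> $ 1 * Y \<rho> $ 1 + (Y \<rho> $ 1)\<^sup>2) / 3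
          * (Drho Y \<rho> $ 2 - Drho X \<rho> $ 2))"
  have "(q has_integral (Q 1 - Q 0)) {0..1}"
  proof (rule fundamental_theorem_of_calculus_interior_strong)
    show "finite (node J ` {0..J})" by simp
    show "continuous_on {0..1} Q"
      unfolding Q_def by (intro continuous_intros cont) auto
    fix \<rho> :: real assume "\<rho> \<in> {0<..<1} - node J ` {0..J}"
    then have \<rho>: "\<rho> \<in> {0..1} - node J ` {0..J}" by auto
    note d = Vh2_component_has_derivative[OF X J \<rho>] Vh2_component_has_derivative[OF Y J \<rho>]
    show "(Q has_vector_derivative q \<rho>) (at \<rho>)"
      unfolding Q_def q_def has_real_derivative_iff_has_vector_derivative[symmetric]
      by (rule derivative_eq_intros d refl | simp)+ (simp add: field_simps)
  qed simp
  then have "((\<lambda>\<rho>. 2 * ((Y \<rho> - X \<rho>) \<bullet> f_half X Y \<rho>)) has_integral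
     (integral {0..1} (\<lambda>\<rho>. (X \<rho> $ 1)\<^sup>2 * Drho X \<rho> $ 2)
     - integral {0..1} (\<lambda>\<rho>. (Y \<rho> $ 1)\<^sup>2 * Drho Y \<rho> $ 2) + (Q 1 - Q 0))) {0..1}"
    unfolding volume_density_identity q_def
    by (intro has_integral_add has_integral_diff integrable_integral
        integrable_volume_density[OF X J] integrable_volume_density[OF Y J])
  then show ?thesis
    unfolding L2_inner_def by (simp flip: integral_mult_right add: integral_unique)
qed

lemma Vh2_add: "\<lbrakk>X \<in> Vh2 I J; D \<in> Vh2 I J\<rbrakk> \<Longrightarrow> (\<lambda>\<rho>. X \<rho> + D \<rho>) \<in> Vh2 I J"
proof -
  have "(\<lambda>\<rho>. u \<rho> + v \<rho>) \<in> Vh I J" if u: "u \<in> Vh I J" and v: "v \<in> Vh I J" for u v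
  proof -
    have "\<exists>a b. \<forall>\<rho>\<in>{node J (j - 1)..node J j}. u \<rho> + v \<rho> = a + b * \<rho>" if j: "j \<in> {1..J}" for j
    proof -
      obtain a b where "\<And>\<rho>. \<rho> \<in> {node J (j - 1)..node J j} \<Longrightarrow> u \<rho> = a + b * \<rho>"
        using Vh_affine[OF u j] by blast
      moreover obtain a' b' where "\<And>\<rho>. \<rho> \<in> {node J (j - 1)..node J j} \<Longrightarrow> v \<rho> = a' + b' * \<rho>"
        using Vh_affine[OF v j] by blast
      ultimately show ?thesis
        by (intro exI[of _ "a + a'"] exI[of _ "b + b'"]) (simp add: algebra_simps)
    qed
    then show ?thesis
      using u v by (auto simp: Vh_def intro: continuous_on_add)
  qed
  then show "X \<in> Vh2 I J \<Longrightarrow> D \<in> Vh2 I J \<Longrightarrow> (\<lambda>\<rho>. X \<rho> + D \<rho>) \<in> Vh2 I J"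
    by (simp add: Vh2_def)
qed

text \<open>
  The boundary values that the integration by parts leaves are the change of the boundary term of
  the volume.  On each part of the boundary a different factor is responsible: \<open>(Y - X) $ 2\<close>
  vanishes on \<open>BD\<close> and \<open>B2\<close>, both radii vanish on \<open>B0\<close>, and on \<open>B1\<close> the radii agree, so that the
  quadratic form divided by 3 is the squared radius.
\<close>

lemma boundary_values:
  fixes X Y :: "real \<Rightarrow> real^2"
  defines "Q \<equiv> \<lambda>\<rho>. ((X \<rho> $ 1)\<^sup>2 + X \<rho> $ 1 * Y \<rho> $ 1 + (Y \<rho> $ 1)\<^sup>2) / 3 * (Y \<rho> $ 2 - X \<rho> $ 2)"
  assumes part: "boundary_partition I BD B0 B1 B2"
    and X: "X \<in> Vh2_axis I J B0"
    and D: "(\<lambda>\<rho>. Y \<rho> - X \<rho>) \<in> Vh2_bdry I J BD B0 B1 B2"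
  shows "(\<Sum>p\<in>B1. (-1) ^ (nat \<lfloor>p\<rfloor> + 1) * (Y p $ 1)\<^sup>2 * (Y p $ 2))
     - (\<Sum>p\<in>B1. (-1) ^ (nat \<lfloor>p\<rfloor> + 1) * (X p $ 1)\<^sup>2 * (X p $ 2)) = Q 1 - Q 0"
proof (cases I)
  case Circle
  have "B1 = {}"
    using part Circle by (auto simp: boundary_partition_def dom_boundary_def)
  have "X 1 $ i = X 0 $ i" "(Y 1 - X 1) $ i = (Y 0 - X 0) $ i" for i
    using X D Circle Vh_circle_closed[of "\<lambda>\<rho>. X \<rho> $ i" J]
      Vh_circle_closed[of "\<lambda>\<rho>. (Y \<rho> - X \<rho>) $ i" J]
    unfolding Vh2_bdry_def Vh2_axis_def Vh2_def by blast+
  then have "Q 1 = Q 0"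
    by (simp add: Q_def)
  then show ?thesis
    using \<open>B1 = {}\<close> by simp
next
  case Interval
  have bdry: "BD \<union> B0 \<union> B1 \<union> B2 = {0, 1}"
    using part Interval by (auto simp: boundary_partition_def dom_boundary_def)
  have on_B1: "Y p $ 1 = X p $ 1" if "p \<in> B1" for p
    using D that by (simp add: Vh2_bdry_def)
  have Q_B1: "Q p = (X p $ 1)\<^sup>2 * (Y p $ 2 - X p $ 2)" if "p \<in> B1" for p
    using on_B1[OF that] by (simp add: Q_def power2_eq_square)
  have Q_rest: "Q p = 0" if p: "p \<in> {0, 1}" "p \<notin> B1" for p
  proof -
    have "X p $ 1 = 0 \<and> Y p $ 1 = 0" if "p \<in> B0"
      using X D that by (auto simp: Vh2_bdry_def Vh2_axis_def)
    moreover have "Y p $ 2 = X p $ 2" if "p \<in> BD \<union> B2"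
      using D that by (auto simp: Vh2_bdry_def)
    ultimately show ?thesis
      using p bdry unfolding Q_def by force
  qed
  have "(\<Sum>p\<in>B1. (-1) ^ (nat \<lfloor>p\<rfloor> + 1) * (Y p $ 1)\<^sup>2 * (Y p $ 2))
     - (\<Sum>p\<in>B1. (-1) ^ (nat \<lfloor>p\<rfloor> + 1) * (X p $ 1)\<^sup>2 * (X p $ 2))
     = (\<Sum>p\<in>B1. (-1) ^ (nat \<lfloor>p\<rfloor> + 1) * Q p)"
    unfolding sum_subtractf[symmetric]
    by (intro sum.cong refl) (simp add: on_B1 Q_B1 algebra_simps)
  also have "\<dots> = (\<Sum>p\<in>{0, 1}. (-1) ^ (nat \<lfloor>p\<rfloor> + 1) * Q p)"
    using bdry Q_rest by (intro sum.mono_neutral_left) auto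
  \<comment> \<open>The sign \<open>(-1) ^ (p + 1)\<close> is the outward orientation of the end point.\<close>
  also have "\<dots> = Q 1 - Q 0"
    by simp
  finally show ?thesis .
qed

text \<open>
  This is the reason for the weights in \<open>f_half\<close>: with them the first-order variation of the
  volume becomes an exact formula for a step of any size.
\<close>

lemma enclosed_volume_change:
  assumes "J > 0" "boundary_partition I BD B0 B1 B2" "X \<in> Vh2_axis I J B0"
    and "(\<lambda>\<rho>. Y \<rho> - X \<rho>) \<in> Vh2_bdry I J BD B0 B1 B2"
  shows "enclosed_volume B1 Y - enclosed_volume B1 X
     = 2 * pi * L2_inner (\<lambda>\<rho>. Y \<rho> - X \<rho>) (f_half X Y)"
proof -
  have X: "X \<in> Vh2 I J"
    using assms(3) by (simp add: Vh2_axis_def)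
  have Y: "Y \<in> Vh2 I J"
    using Vh2_add[OF X, of "\<lambda>\<rho>. Y \<rho> - X \<rho>"] assms(4) by (simp add: Vh2_bdry_def Vh2_axis_def)
  have "enclosed_volume B1 Y - enclosed_volume B1 X
     = pi * (2 * L2_inner (\<lambda>\<rho>. Y \<rho> - X \<rho>) (f_half X Y))"
    unfolding volume_density_change[OF X Y assms(1)] boundary_values[OF assms(2-4), symmetric]
      enclosed_volume_eq
    by (simp add: algebra_simps)
  then show ?thesis by simp
qed

section \<open>Volume conservation of the scheme\<close>

theorem theorem3p3:
  fixes I :: domain and J :: nat
    and BD B0 B1 B2 :: "real set"
    and \<Delta>t :: real
    and X Y \<omega> :: "real \<Rightarrow> real^2"
    and \<kappa> l :: "real \<Rightarrow> real"
  assumes "J \<ge> 3"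
    and "boundary_partition I BD B0 B1 B2"
    and "\<Delta>t > 0"
    and "X \<in> Vh2_axis I J B0"
    and "(\<lambda>\<rho>. Y \<rho> - X \<rho>) \<in> Vh2_bdry I J BD B0 B1 B2"
    and "\<kappa> \<in> Vh I J"
    and "admissible_curve I J B0 X"
    and "admissible_curve I J B0 Y"
    and "is_omega I J X \<omega>"
    and "is_lambda I J B0 X \<omega> \<kappa> l"
    and "\<forall>\<zeta>\<in>Vh I J.
           (1 / \<Delta>t) * L2_inner (\<lambda>\<rho>. Y \<rho> - X \<rho>) (\<lambda>\<rho>. \<zeta> \<rho> *\<^sub>R f_half X Y \<rho>)
           - L2_inner (\<lambda>\<rho>. (X \<rho> \<bullet> e1) * Drho (\<lambda>s. \<kappa> s - l s) \<rho>)
                      (\<lambda>\<rho>. Drho \<zeta> \<rho> * inverse (norm (Drho X \<rho>))) = 0"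
    and "\<forall>\<eta>\<in>Vh2_bdry I J BD B0 B1 B2.
           lumped_inner J (\<lambda>\<rho>. \<kappa> \<rho> *\<^sub>R unit_normal X \<rho>) (\<lambda>\<rho>. norm (Drho X \<rho>) *\<^sub>R \<eta> \<rho>)
           + L2_inner (Drho Y) (\<lambda>\<rho>. inverse (norm (Drho X \<rho>)) *\<^sub>R Drho \<eta> \<rho>) = 0"
  shows "enclosed_volume B1 Y = enclosed_volume B1 X"
proof -
  have one: "(\<lambda>_. 1) \<in> Vh I J"
    unfolding Vh_def by (auto intro: exI[of _ "1 :: real"] exI[of _ "0 :: real"])
  have "(1 / \<Delta>t) * L2_inner (\<lambda>\<rho>. Y \<rho> - X \<rho>) (\<lambda>\<rho>. 1 *\<^sub>R f_half X Y \<rho>)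
      - L2_inner (\<lambda>\<rho>. (X \<rho> \<bullet> e1) * Drho (\<lambda>s. \<kappa> s - l s) \<rho>)
          (\<lambda>\<rho>. Drho (\<lambda>_. 1 :: real) \<rho> * inverse (norm (Drho X \<rho>))) = 0"
    using assms(11) one by (rule bspec)
  moreover have "Drho (\<lambda>_. 1 :: real) = (\<lambda>_. 0)"
    by (simp add: Drho_def fun_eq_iff)
  ultimately have "L2_inner (\<lambda>\<rho>. Y \<rho> - X \<rho>) (f_half X Y) = 0"
    using assms(3) by (simp add: L2_inner_def)
  then show ?thesis
    using enclosed_volume_change[of J I BD B0 B1 B2 X Y] assms(1,2,4,5) by simp
qed

end
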